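(* Let $A$ be an $N\times N$ symmetric positive definite matrix and let $A^{(1)}$ and $B^{(k)}$, $k\in\{2,\dots,q\}$, be the matrices produced by the exact gamblet transform described in the context. Assume that there exist constants $C_{\mathfrak d}\ge 1$ and $H\in(0,1)$ such that (i) $\displaystyle \frac{1}{C_{\mathfrak d}\sqrt{\lambda_{\min}(A)}}H^k\le \inf_{0\neq x\in \operatorname{Im}(\pi^{(q,k)})}\frac{\sqrt{x^TA^{-1}x}}{|x|}$ for $k\in\{1,\dots,q\}$, and (ii) $\displaystyle \sup_{0\ne x\in\operatorname{Ker}(\pi^{(k,q)})}\frac{\sqrt{x^TA^{-1}x}}{|x|}\le \frac{C_{\mathfrak d}}{\sqrt{\lambda_{\min}(A)}}H^k$ for $k\in\{1,\dots,q-1\}$. Then there exists a constant $C$ depending only on $C_{\mathfrak d}$ such that $$C^{-1}I^{(1)}\le \frac{A^{(1)}}{\lambda_{\min}(A)}\le CH^{-2}I^{(1)},\qquad \operatorname{Cond}(A^{(1)})\le CH^{-2},$$ and, for $k\in\{2,\dots,q\}$, $$C^{-1}H^{-2(k-1)}J^{(k)}\le\frac{B^{(k)}}{\lambda_{\min}(A)}\le CH^{-2k}J^{(k)},\qquad \operatorname{Cond}(B^{(k)})\le CH^{-2}.$$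
   Context: $|\cdot|$ is the Euclidean norm, $\lambda_{\min},\lambda_{\max}$ extreme eigenvalues, $\operatorname{Cond}(X)=\lambda_{\max}(X)/\lambda_{\min}(X)$ for symmetric positive definite $X$; matrix inequalities are in the sense of quadratic forms. Index tree: $\mathcal I^{(q)}$ is a finite set of $q$-tuples $i=(i_1,\dots,i_q)$ with $N$ elements, used to relabel $\{1,\dots,N\}$ (so $\mathbb R^N=\mathbb R^{\mathcal I^{(q)}}$). For a tuple $i$ of length $\geq k$, $i^{(k)}:=(i_1,\dots,i_k)$, and $\mathcal I^{(k)}:=\{i^{(k)}: i\in\mathcal I^{(q)}\}$. $I^{(k)}$ is the $\mathcal I^{(k)}\times\mathcal I^{(k)}$ identity matrix. For $k\in\{1,\dots,q-1\}$, $\pi^{(k,k+1)}$ is an $\mathcal I^{(k)}\times\mathcal I^{(k+1)}$ matrix with $\pi^{(k,k+1)}(\pi^{(k,k+1)})^T=I^{(k)}$; $\pi^{(k,q)}:=\pi^{(k,k+1)}\pi^{(k+1,k+2)}\cdots\pi^{(q-1,q)}$, $\pi^{(q,q)}:=I^{(q)}$, and $\pi^{(q,k)}:=(\pi^{(k,q)})^T$. For $k\in\{2,\dots,q\}$, $\mathcal J^{(k)}$ is a finite set of $k$-tuples with $\{j^{(k-1)}:j\in\mathcal J^{(k)}\}=\mathcal I^{(k-1)}$ and, for each $i\in\mathcal I^{(k-1)}$, $\#\{j\in\mathcal J^{(k)}:j^{(k-1)}=i\}=\#\{s\in\mathcal I^{(k)}:s^{(k-1)}=i\}-1$. $J^{(k)}$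 is the $\mathcal J^{(k)}\times\mathcal J^{(k)}$ identity. $W^{(k)}$ is a $\mathcal J^{(k)}\times\mathcal I^{(k)}$ matrix with $\operatorname{Im}(W^{(k),T})=\operatorname{Ker}(\pi^{(k-1,k)})$ and $W^{(k)}W^{(k),T}=J^{(k)}$. Exact gamblet transform (matrices): set $A^{(q)}=A$. For $k=q,q-1,\dots,2$: $B^{(k)}=W^{(k)}A^{(k)}W^{(k),T}$; $N^{(k)}=A^{(k)}W^{(k),T}(B^{(k)})^{-1}$; $R^{(k-1,k)}=\pi^{(k-1,k)}(I^{(k)}-N^{(k)}W^{(k)})$; $A^{(k-1)}=R^{(k-1,k)}A^{(k)}(R^{(k-1,k)})^T$. *)

theory Defs
  imports
    Jordan_Normal_Form.Matrix_Kernel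
    Jordan_Normal_Form.Gauss_Jordan_Elimination
    Jordan_Normal_Form.Spectral_Radius
    "HOL-Library.Countable_Set"
begin

section \<open>Real matrices and quadratic forms\<close>

definition vec_len :: "real vec \<Rightarrow> real" where
  "vec_len x = sqrt (x \<bullet> x)"

definition mat_image :: "real mat \<Rightarrow> real vec set" where
  "mat_image X = (\<lambda>v. X *\<^sub>v v) ` carrier_vec (dim_col X)"

definition sym_pos_def :: "nat \<Rightarrow> real mat \<Rightarrow> bool" where
  "sym_pos_def n X \<longleftrightarrow> X \<in> carrier_mat n n \<and> X\<^sup>T = X \<and>
     (\<forall>v \<in> carrier_vec n. v \<noteq> 0\<^sub>v n \<longrightarrow> 0 < v \<bullet> (X *\<^sub>v v))"

definition loewner_le :: "nat \<Rightarrow> real mat \<Rightarrow> real mat \<Rightarrow> bool" where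
  "loewner_le n X Y \<longleftrightarrow> X \<in> carrier_mat n n \<and> Y \<in> carrier_mat n n \<and>
     (\<forall>v \<in> carrier_vec n. v \<bullet> (X *\<^sub>v v) \<le> v \<bullet> (Y *\<^sub>v v))"

definition lambda_min :: "real mat \<Rightarrow> real" where
  "lambda_min X = Min (spectrum X)"

definition lambda_max :: "real mat \<Rightarrow> real" where
  "lambda_max X = Max (spectrum X)"

definition cond_number :: "real mat \<Rightarrow> real" where
  "cond_number X = lambda_max X / lambda_min X"

text \<open>The value is unspecified for a singular matrix.\<close>

definition minv :: "real mat \<Rightarrow> real mat" where
  "minv X = the (mat_inverse X)"


section \<open>Index trees\<close>

text \<open>Tuples are lists of natural numbers, and the truncation \<open>i\<close> to its first \<open>k\<close>
  entries is \<open>take k i\<close>.\<close>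

definition index_tree :: "nat \<Rightarrow> nat \<Rightarrow> nat list set \<Rightarrow> bool" where
  "index_tree q n I \<longleftrightarrow> 1 \<le> q \<and> 1 \<le> n \<and> finite I \<and> card I = n \<and> (\<forall>i\<in>I. length i = q)"

definition level :: "nat list set \<Rightarrow> nat \<Rightarrow> nat list set" where
  "level I k = take k ` I"

definition wavelet_index :: "nat \<Rightarrow> nat list set \<Rightarrow> (nat \<Rightarrow> nat list set) \<Rightarrow> bool" where
  "wavelet_index q I J \<longleftrightarrow> (\<forall>k\<in>{2..q}.
     finite (J k) \<and> (\<forall>j\<in>J k. length j = k) \<and> take (k - 1) ` J k = level I (k - 1) \<and>
     (\<forall>i\<in>level I (k - 1).
        card {j \<in> J k. take (k - 1) j = i} = card {s \<in> level I k. take (k - 1) s = i} - 1))"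

text \<open>An \<open>S \<times> T\<close> matrix with entries \<open>f s t\<close>, stored as a \<open>card S \<times> card T\<close> matrix:
  row \<open>r\<close> belongs to the \<open>r\<close>-th element of \<open>S\<close> in the fixed enumeration
  \<open>from_nat_into S\<close>, a bijection from \<open>{..<card S}\<close> onto \<open>S\<close> for finite \<open>S\<close>; likewise for
  the columns. The same enumeration identifies vectors indexed by \<open>S\<close> with
  \<open>carrier_vec (card S)\<close>.\<close>

definition index_mat :: "'a set \<Rightarrow> 'b set \<Rightarrow> ('a \<Rightarrow> 'b \<Rightarrow> real) \<Rightarrow> real mat" where
  "index_mat S T f =
     mat (card S) (card T) (\<lambda>(r, c). f (from_nat_into S r) (from_nat_into T c))"


section \<open>The gamblet hierarchy\<close>

text \<open>\<open>p k\<close> holds the entries of \<open>\<pi>\<^bsup>(k,k+1)\<^esup>\<close>, and \<open>w k\<close> those of \<open>W\<^bsup>(k)\<^esup>\<close>.\<close>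

definition pi_step ::
  "nat list set \<Rightarrow> (nat \<Rightarrow> nat list \<Rightarrow> nat list \<Rightarrow> real) \<Rightarrow> nat \<Rightarrow> real mat" where
  "pi_step I p k = index_mat (level I k) (level I (k + 1)) (p k)"

text \<open>\<open>\<pi>\<^bsup>(k,q)\<^esup>\<close>; for \<open>k = q\<close> the product is empty and gives the identity.\<close>

definition pi_top ::
  "nat \<Rightarrow> nat list set \<Rightarrow> (nat \<Rightarrow> nat list \<Rightarrow> nat list \<Rightarrow> real) \<Rightarrow> nat \<Rightarrow> real mat" where
  "pi_top q I p k = foldr (\<lambda>l M. pi_step I p l * M) [k..<q] (1\<^sub>m (card (level I q)))"

definition wavelet_mat ::
  "nat list set \<Rightarrow> (nat \<Rightarrow> nat list set) \<Rightarrow> (nat \<Rightarrow> nat list \<Rightarrow> nat list \<Rightarrow> real) \<Rightarrow> nat \<Rightarrow> real mat"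
  where "wavelet_mat I J w k = index_mat (J k) (level I k) (w k)"

definition orthonormal_pi ::
  "nat \<Rightarrow> nat list set \<Rightarrow> (nat \<Rightarrow> nat list \<Rightarrow> nat list \<Rightarrow> real) \<Rightarrow> bool" where
  "orthonormal_pi q I p \<longleftrightarrow> (\<forall>k\<in>{1..q - 1}.
     pi_step I p k * (pi_step I p k)\<^sup>T = 1\<^sub>m (card (level I k)))"

definition orthonormal_wavelets ::
  "nat \<Rightarrow> nat list set \<Rightarrow> (nat \<Rightarrow> nat list set) \<Rightarrow> (nat \<Rightarrow> nat list \<Rightarrow> nat list \<Rightarrow> real) \<Rightarrow>
   (nat \<Rightarrow> nat list \<Rightarrow> nat list \<Rightarrow> real) \<Rightarrow> bool" where
  "orthonormal_wavelets q I J p w \<longleftrightarrow> (\<forall>k\<in>{2..q}.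
     mat_image ((wavelet_mat I J w k)\<^sup>T) = mat_kernel (pi_step I p (k - 1)) \<and>
     wavelet_mat I J w k * (wavelet_mat I J w k)\<^sup>T = 1\<^sub>m (card (J k)))"

text \<open>The matrices \<open>A k\<close>, \<open>B k\<close>, \<open>N k\<close> and \<open>R k\<close> (which is \<open>R\<^bsup>(k-1,k)\<^esup>\<close>) are those produced
  by the exact gamblet transform of \<open>A0\<close>; the equations determine \<open>A k\<close> for \<open>1 \<le> k \<le> q\<close> and
  the other matrices for \<open>2 \<le> k \<le> q\<close>.\<close>

definition gamblet_transform ::
  "nat \<Rightarrow> nat list set \<Rightarrow> (nat \<Rightarrow> nat list set) \<Rightarrow> (nat \<Rightarrow> nat list \<Rightarrow> nat list \<Rightarrow> real) \<Rightarrow>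
   (nat \<Rightarrow> nat list \<Rightarrow> nat list \<Rightarrow> real) \<Rightarrow> real mat \<Rightarrow>
   (nat \<Rightarrow> real mat) \<Rightarrow> (nat \<Rightarrow> real mat) \<Rightarrow> (nat \<Rightarrow> real mat) \<Rightarrow> (nat \<Rightarrow> real mat) \<Rightarrow> bool" where
  "gamblet_transform q I J p w A0 A B N R \<longleftrightarrow> A q = A0 \<and> (\<forall>k\<in>{2..q}.
     (let W = wavelet_mat I J w k in
       B k = W * A k * W\<^sup>T \<and>
       N k = A k * W\<^sup>T * minv (B k) \<and>
       R k = pi_step I p (k - 1) * (1\<^sub>m (card (level I k)) - N k * W) \<and>
       A (k - 1) = R k * A k * (R k)\<^sup>T))"

text \<open>The quantity under the infimum and supremum: the \<open>A\<^sup>-\<^sup>1\<close>-norm over the Euclidean norm.\<close>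

definition inv_energy_ratio :: "real mat \<Rightarrow> real vec \<Rightarrow> real" where
  "inv_energy_ratio A x = sqrt (x \<bullet> (minv A *\<^sub>v x)) / vec_len x"

end

theory Submission
  imports Defs
begin

text \<open>With \<open>\<Theta>\<^bsup>(k)\<^esup> = \<pi>\<^bsup>(k,q)\<^esup> A\<inverse> \<pi>\<^bsup>(q,k)\<^esup>\<close>, each step of the transform is a Schur complement, so
  \<open>A\<^bsup>(k)\<^esup>\<close> is the inverse of \<open>\<Theta>\<^bsup>(k)\<^esup>\<close>. Hence \<open>\<Theta>\<^bsup>(k)\<^esup> \<le> 1 / \<lambda>\<close>, with \<open>\<lambda>\<close> the smallest eigenvalue of
  \<open>A\<close>, gives \<open>A\<^bsup>(k)\<^esup> \<ge> \<lambda>\<close>, and hypothesis (i) bounds \<open>A\<^bsup>(k)\<^esup>\<close> and \<open>B\<^bsup>(k)\<^esup>\<close> from above. For the lower bound on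
  \<open>B\<^bsup>(k)\<^esup>\<close>, put \<open>z = W\<^bsup>(k),T\<^esup> y\<close>: Cauchy-Schwarz gives \<open>|z|\<^sup>4 \<le> (z\<^sup>T A\<^bsup>(k)\<^esup> z) (z\<^sup>T \<Theta>\<^bsup>(k)\<^esup> z)\<close>, and since
  \<open>\<pi>\<^bsup>(q,k)\<^esup> z\<close> lies in the kernel of \<open>\<pi>\<^bsup>(k-1,q)\<^esup>\<close>, hypothesis (ii) bounds the last factor.\<close>

section \<open>Quadratic forms and extreme eigenvalues\<close>

lemma quadratic_nonneg_discriminant:
  fixes a b c :: real
  assumes "\<And>t. 0 \<le> a + 2 * t * b + t\<^sup>2 * c"
  shows "b\<^sup>2 \<le> a * c"
proof (cases "c = 0")
  case True
  show ?thesis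
  proof (cases "b = 0")
    case False
    \<comment> \<open>At this \<open>t\<close> the affine function takes the value -1.\<close>
    then show ?thesis using assms[of "- (a + 1) / (2 * b)"] True by (simp add: field_simps)
  qed (simp add: True)
next
  case False
  have "c > 0"
  proof (rule ccontr)
    assume "\<not> c > 0"
    with False have c: "c < 0" by simp
    \<comment> \<open>Averaging over \<open>t\<close> and \<open>- t\<close> cancels the linear
      term; the square root chosen below then makes the remainder equal to -1.\<close>
    have t: "0 \<le> a + t\<^sup>2 * c" for t
      using assms[of t] assms[of "- t"] by simp
    have "0 \<le> a" using assms[of 0] by simp
    then have "(sqrt ((a + 1) / - c))\<^sup>2 = (a + 1) / - c"
      using c by (intro real_sqrt_pow2 divide_nonneg_pos) auto
    then show False using t[of "sqrt ((a + 1) / - c)"] c by simp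
  qed
  then show ?thesis using assms[of "- b / c"] by (simp add: field_simps power2_eq_square)
qed

lemma scalar_prod_self_nonneg: "0 \<le> x \<bullet> (x :: real vec)"
  by (simp add: scalar_prod_def sum_nonneg)

lemma scalar_prod_self_pos:
  fixes x :: "real vec"
  assumes "x \<in> carrier_vec n" "x \<noteq> 0\<^sub>v n"
  shows "0 < x \<bullet> x"
  using conjugate_square_greater_0_vec[of x n] assms by (simp add: conjugate_real_def conjugate_vec_def)

lemma smult_mat_mult_vec:
  fixes A :: "'a :: comm_ring_1 mat"
  assumes "dim_col A = dim_vec v"
  shows "(a \<cdot>\<^sub>m A) *\<^sub>v v = a \<cdot>\<^sub>v (A *\<^sub>v v)"
  using assms by (intro eq_vecI) (auto simp: smult_scalar_prod_distrib[of _ "dim_vec v"])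

lemma symmetric_form_swap:
  fixes M :: "real mat"
  assumes M: "M \<in> carrier_mat n n" "M\<^sup>T = M" and x: "x \<in> carrier_vec n" and y: "y \<in> carrier_vec n"
  shows "y \<bullet> (M *\<^sub>v x) = x \<bullet> (M *\<^sub>v y)"
  using transpose_vec_mult_scalar[OF M(1) x y] M x y
  by (simp add: comm_scalar_prod[of "M *\<^sub>v y" n])

text \<open>The discriminant inequality for the form along the line \<open>x + t y\<close>.
  Semidefiniteness is the right generality, since the Rayleigh argument applies this to a shifted
  matrix known only to be semidefinite.\<close>

lemma psd_cauchy_schwarz:
  fixes M :: "real mat"
  assumes M: "M \<in> carrier_mat n n" "M\<^sup>T = M"
    and psd: "\<And>v. v \<in> carrier_vec n \<Longrightarrow> 0 \<le> v \<bullet> (M *\<^sub>v v)"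
    and x: "x \<in> carrier_vec n" and y: "y \<in> carrier_vec n"
  shows "(x \<bullet> (M *\<^sub>v y))\<^sup>2 \<le> (x \<bullet> (M *\<^sub>v x)) * (y \<bullet> (M *\<^sub>v y))"
proof (rule quadratic_nonneg_discriminant)
  fix t :: real
  have "M *\<^sub>v (x + t \<cdot>\<^sub>v y) = M *\<^sub>v x + t \<cdot>\<^sub>v (M *\<^sub>v y)"
    using M x y by (simp add: mult_add_distrib_mat_vec mult_mat_vec)
  then have "(x + t \<cdot>\<^sub>v y) \<bullet> (M *\<^sub>v (x + t \<cdot>\<^sub>v y))
      = x \<bullet> (M *\<^sub>v x) + 2 * t * (x \<bullet> (M *\<^sub>v y)) + t\<^sup>2 * (y \<bullet> (M *\<^sub>v y))"
    using M x y symmetric_form_swap[OF M x y]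
    by (simp add: add_scalar_prod_distrib[of _ n] scalar_prod_add_distrib[of _ n]
        power2_eq_square algebra_simps)
  then show "0 \<le> x \<bullet> (M *\<^sub>v x) + 2 * t * (x \<bullet> (M *\<^sub>v y)) + t\<^sup>2 * (y \<bullet> (M *\<^sub>v y))"
    using psd[of "x + t \<cdot>\<^sub>v y"] x y by simp
qed

text \<open>Any finite bound will do: it keeps the Rayleigh quotient bounded below and controls the
  form of an inverse.\<close>

lemma quadratic_form_bounded:
  fixes M :: "real mat"
  assumes M: "M \<in> carrier_mat n n"
  obtains K where "0 < K" "\<And>x. x \<in> carrier_vec n \<Longrightarrow> \<bar>x \<bullet> (M *\<^sub>v x)\<bar> \<le> K * (x \<bullet> x)"
proof
  \<comment> \<open>The summand 1 keeps \<open>K\<close> positive even for the zero matrix, so that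
    one may divide by it.\<close>
  define K where "K = 1 + (\<Sum>i<n. \<Sum>j<n. \<bar>M $$ (i, j)\<bar>)"
  show "0 < K" by (simp add: K_def add_pos_nonneg sum_nonneg)
  fix x :: "real vec" assume x: "x \<in> carrier_vec n"
  have le: "\<bar>x $ i\<bar> * \<bar>x $ j\<bar> \<le> x \<bullet> x" if "i < n" "j < n" for i j
  proof -
    have sq: "(x $ i)\<^sup>2 \<le> x \<bullet> x" if "i < n" for i
      using member_le_sum[of i "{..<n}" "\<lambda>i. (x $ i)\<^sup>2"] that x
      by (simp add: scalar_prod_def power2_eq_square lessThan_atLeast0)
    have "0 \<le> (\<bar>x $ i\<bar> - \<bar>x $ j\<bar>)\<^sup>2" by simp
    then show ?thesis using sq[OF that(1)] sq[OF that(2)]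
      by (simp add: power2_diff)
  qed
  have "x \<bullet> (M *\<^sub>v x) = (\<Sum>i<n. \<Sum>j<n. M $$ (i, j) * (x $ i * x $ j))"
    using M x by (simp add: scalar_prod_def lessThan_atLeast0 sum_distrib_left ac_simps)
  also have "\<bar>\<dots>\<bar> \<le> (\<Sum>i<n. \<Sum>j<n. \<bar>M $$ (i, j)\<bar> * (\<bar>x $ i\<bar> * \<bar>x $ j\<bar>))"
    by (intro order_trans[OF sum_abs] sum_mono) (simp add: abs_mult)
  also have "\<dots> \<le> (\<Sum>i<n. \<Sum>j<n. \<bar>M $$ (i, j)\<bar> * (x \<bullet> x))"
    by (intro sum_mono mult_left_mono le) auto
  also have "\<dots> = (K - 1) * (x \<bullet> x)"
    by (simp add: K_def sum_distrib_right)
  also have "\<dots> \<le> K * (x \<bullet> x)"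
    by (simp add: algebra_simps scalar_prod_self_nonneg)
  finally show "\<bar>x \<bullet> (M *\<^sub>v x)\<bar> \<le> K * (x \<bullet> x)" .
qed

text \<open>Cauchy-Schwarz in the form of \<open>M\<close> for the pair \<open>x\<close> and
  \<open>P x\<close>: since \<open>M (P x) = x\<close>, the mixed term is
  \<open>x \<bullet> x\<close>, and the form of \<open>M\<close> at \<open>P x\<close> is that of
  \<open>P\<close> at \<open>x\<close>.\<close>

lemma inverse_form_lower_bound:
  fixes M P :: "real mat"
  assumes M: "M \<in> carrier_mat n n" "M\<^sup>T = M"
    and psd: "\<And>v. v \<in> carrier_vec n \<Longrightarrow> 0 \<le> v \<bullet> (M *\<^sub>v v)"
    and P: "P \<in> carrier_mat n n" "M * P = 1\<^sub>m n" and x: "x \<in> carrier_vec n"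
  shows "(x \<bullet> x)\<^sup>2 \<le> (x \<bullet> (M *\<^sub>v x)) * (x \<bullet> (P *\<^sub>v x))"
proof -
  have Px: "P *\<^sub>v x \<in> carrier_vec n" using P x by simp
  have "M *\<^sub>v (P *\<^sub>v x) = x" using M P x by (simp flip: assoc_mult_mat_vec)
  then show ?thesis
    using psd_cauchy_schwarz[OF M psd x Px] comm_scalar_prod[OF Px x] by simp
qed

lemma inverse_symmetric:
  fixes M P :: "real mat"
  assumes M: "M \<in> carrier_mat n n" "M\<^sup>T = M" and P: "P \<in> carrier_mat n n" "M * P = 1\<^sub>m n"
  shows "P\<^sup>T = P"
proof -
  have "P\<^sup>T = P\<^sup>T * (M * P)" using P by simp
  also have "\<dots> = (M * P)\<^sup>T * P" using M P transpose_mult[OF M(1) P(1)]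
    by (metis assoc_mult_mat transpose_carrier_mat)
  also have "\<dots> = P" using P by simp
  finally show ?thesis .
qed

lemma inverse_sym_pos_def:
  fixes M P :: "real mat"
  assumes spd: "sym_pos_def n M" and P: "P \<in> carrier_mat n n" "M * P = 1\<^sub>m n"
  shows "sym_pos_def n P"
  unfolding sym_pos_def_def
proof (intro conjI ballI impI)
  from spd have M: "M \<in> carrier_mat n n" "M\<^sup>T = M" by (auto simp: sym_pos_def_def)
  show "P\<^sup>T = P" by (rule inverse_symmetric[OF M P])
  fix v :: "real vec" assume v: "v \<in> carrier_vec n" "v \<noteq> 0\<^sub>v n"
  have eq: "M *\<^sub>v (P *\<^sub>v v) = v" using M P v by (simp flip: assoc_mult_mat_vec)
  then have "P *\<^sub>v v \<noteq> 0\<^sub>v n" using v M by (metis mult_mat_vec_carrier eq_vecI zero_carrier_vec scalar_prod_right_zero index_mult_mat_vec carrier_matD carrier_vecD row_carrier_vec index_zero_vec)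
  moreover have "P *\<^sub>v v \<in> carrier_vec n" using P v by simp
  ultimately have "0 < (P *\<^sub>v v) \<bullet> (M *\<^sub>v (P *\<^sub>v v))"
    using spd by (auto simp: sym_pos_def_def)
  then show "0 < v \<bullet> (P *\<^sub>v v)"
    using eq v P by (simp add: comm_scalar_prod[of v n])
qed (use P in auto)

text \<open>\<open>minv\<close> applies \<open>the\<close> to an option; a trivial kernel gives a
  nonzero determinant, which excludes \<open>None\<close>.\<close>

lemma nonsingular_inverse:
  fixes M :: "real mat"
  assumes M: "M \<in> carrier_mat n n"
    and inj: "\<And>v. v \<in> carrier_vec n \<Longrightarrow> M *\<^sub>v v = 0\<^sub>v n \<Longrightarrow> v = 0\<^sub>v n"
  shows "minv M \<in> carrier_mat n n" "M * minv M = 1\<^sub>m n" "minv M * M = 1\<^sub>m n"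
proof -
  have "det M \<noteq> 0" using inj det_0_iff_vec_prod_zero_field[OF M] by blast
  then have "mat_inverse M \<noteq> None"
    using mat_inverse(1)[OF M, where b = undefined] det_non_zero_imp_unit[OF M, where b = undefined]
    by blast
  then obtain P where "mat_inverse M = Some P" by blast
  with mat_inverse(2)[OF M this]
  show "minv M \<in> carrier_mat n n" "M * minv M = 1\<^sub>m n" "minv M * M = 1\<^sub>m n"
    by (auto simp: minv_def)
qed

lemma sym_pos_def_minv:
  assumes "sym_pos_def n M"
  shows "minv M \<in> carrier_mat n n" "M * minv M = 1\<^sub>m n" "minv M * M = 1\<^sub>m n"
proof -
  have M: "M \<in> carrier_mat n n" using assms by (simp add: sym_pos_def_def)
  have inj: "v = 0\<^sub>v n" if "v \<in> carrier_vec n" "M *\<^sub>v v = 0\<^sub>v n" for v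
    using assms that by (force simp: sym_pos_def_def)
  show "minv M \<in> carrier_mat n n" "M * minv M = 1\<^sub>m n" "minv M * M = 1\<^sub>m n"
    using nonsingular_inverse[OF M inj] by auto
qed

text \<open>With \<open>\<mu>\<close> the infimum of the Rayleigh quotient, \<open>M - \<mu> I\<close> is positive semidefinite; were it
  invertible, Cauchy-Schwarz would bound its form away from zero, so \<open>\<mu>\<close> is an eigenvalue.\<close>

lemma rayleigh_minimum_eigenvalue:
  fixes M :: "real mat"
  assumes M: "M \<in> carrier_mat n n" "M\<^sup>T = M" and n: "0 < n"
  obtains \<mu> where "eigenvalue M \<mu>" "\<And>v. v \<in> carrier_vec n \<Longrightarrow> \<mu> * (v \<bullet> v) \<le> v \<bullet> (M *\<^sub>v v)"
proof -
  obtain K where K: "\<And>x. x \<in> carrier_vec n \<Longrightarrow> \<bar>x \<bullet> (M *\<^sub>v x)\<bar> \<le> K * (x \<bullet> x)"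
    using quadratic_form_bounded[OF M(1)] by blast
  define S where "S = (\<lambda>v. (v \<bullet> (M *\<^sub>v v)) / (v \<bullet> v)) ` (carrier_vec n - {0\<^sub>v n})"
  define \<mu> where "\<mu> = Inf S"
  have "unit_vec n 0 \<in> carrier_vec n - {0\<^sub>v n}" using n by simp
  then have ne: "S \<noteq> {}" unfolding S_def by blast
  have bdd: "bdd_below S"
    unfolding S_def
  proof (intro bdd_belowI2)
    fix v :: "real vec" assume v: "v \<in> carrier_vec n - {0\<^sub>v n}"
    then have "0 < v \<bullet> v" using scalar_prod_self_pos[of v n] by simp
    moreover have "\<bar>v \<bullet> (M *\<^sub>v v)\<bar> \<le> K * (v \<bullet> v)" using K v by blast
    ultimately show "- K \<le> (v \<bullet> (M *\<^sub>v v)) / (v \<bullet> v)" by (simp add: field_simps)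
  qed
  have mu: "\<mu> * (v \<bullet> v) \<le> v \<bullet> (M *\<^sub>v v)" if v: "v \<in> carrier_vec n" for v
  proof (cases "v = 0\<^sub>v n")
    case True
    then show ?thesis using M by simp
  next
    case False
    then have "\<mu> \<le> (v \<bullet> (M *\<^sub>v v)) / (v \<bullet> v)"
      unfolding \<mu>_def using v bdd by (intro cInf_lower) (auto simp: S_def)
    then show ?thesis using scalar_prod_self_pos[OF v False] by (simp add: field_simps)
  qed
  define D where "D = M - \<mu> \<cdot>\<^sub>m 1\<^sub>m n"
  have D: "D \<in> carrier_mat n n" "D\<^sup>T = D"
  proof -
    have "(\<mu> \<cdot>\<^sub>m 1\<^sub>m n)\<^sup>T = \<mu> \<cdot>\<^sub>m 1\<^sub>m n" by (rule eq_matI) auto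
    then show "D \<in> carrier_mat n n" "D\<^sup>T = D"
      using M by (auto simp: D_def transpose_minus[of _ n n])
  qed
  have Dv: "D *\<^sub>v v = M *\<^sub>v v - \<mu> \<cdot>\<^sub>v v" if "v \<in> carrier_vec n" for v :: "real vec"
    using M that by (simp add: D_def minus_mult_distrib_mat_vec[of _ n n] smult_mat_mult_vec)
  have Dq: "v \<bullet> (D *\<^sub>v v) = v \<bullet> (M *\<^sub>v v) - \<mu> * (v \<bullet> v)" if "v \<in> carrier_vec n" for v :: "real vec"
    using M that by (simp add: Dv scalar_prod_minus_distrib[of _ n])
  have psd: "0 \<le> v \<bullet> (D *\<^sub>v v)" if "v \<in> carrier_vec n" for v :: "real vec"
    using mu that by (simp add: Dq)
  have "\<exists>v\<in>carrier_vec n. v \<noteq> 0\<^sub>v n \<and> D *\<^sub>v v = 0\<^sub>v n"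
  proof (rule ccontr)
    assume "\<not> ?thesis"
    then have P: "minv D \<in> carrier_mat n n" "D * minv D = 1\<^sub>m n"
      using nonsingular_inverse[OF D(1)] by blast+
    obtain L where L: "0 < L" "\<And>x. x \<in> carrier_vec n \<Longrightarrow> \<bar>x \<bullet> (minv D *\<^sub>v x)\<bar> \<le> L * (x \<bullet> x)"
      using quadratic_form_bounded[OF P(1)] by blast
    \<comment> \<open>Invertibility of \<open>D\<close> would separate all Rayleigh quotients from
      their infimum by the gap \<open>1 / L\<close>.\<close>
    have "\<mu> + 1 / L \<le> \<mu>"
      unfolding \<mu>_def
    proof (rule cInf_greatest[OF ne])
      fix s assume "s \<in> S"
      then obtain v where v: "v \<in> carrier_vec n" "v \<noteq> 0\<^sub>v n"
        and s: "s = (v \<bullet> (M *\<^sub>v v)) / (v \<bullet> v)"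
        by (auto simp: S_def)
      have pos: "0 < v \<bullet> v" by (rule scalar_prod_self_pos[OF v])
      have "(v \<bullet> v)\<^sup>2 \<le> (v \<bullet> (D *\<^sub>v v)) * (v \<bullet> (minv D *\<^sub>v v))"
        by (rule inverse_form_lower_bound[OF D psd P v(1)])
      also have "\<dots> \<le> (v \<bullet> (D *\<^sub>v v)) * (L * (v \<bullet> v))"
        using L(2)[OF v(1)] psd[OF v(1)] by (intro mult_left_mono) auto
      finally have "(v \<bullet> v) * (v \<bullet> v) \<le> (L * (v \<bullet> (D *\<^sub>v v))) * (v \<bullet> v)"
        by (simp add: power2_eq_square ac_simps)
      then have "v \<bullet> v \<le> L * (v \<bullet> (D *\<^sub>v v))" using pos by simp
      then show "Inf S + 1 / L \<le> s"
        using pos L(1) by (simp add: s Dq[OF v(1)] \<mu>_def field_simps)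
    qed
    then show False using L(1) by simp
  qed
  then obtain v where v: "v \<in> carrier_vec n" "v \<noteq> 0\<^sub>v n" "D *\<^sub>v v = 0\<^sub>v n" by blast
  have "M *\<^sub>v v = \<mu> \<cdot>\<^sub>v v"
  proof (rule eq_vecI)
    fix i assume i: "i < dim_vec (\<mu> \<cdot>\<^sub>v v)"
    have "(M *\<^sub>v v - \<mu> \<cdot>\<^sub>v v) $ i = 0" using v i Dv by simp
    then show "(M *\<^sub>v v) $ i = (\<mu> \<cdot>\<^sub>v v) $ i" using v i by simp
  qed (use v M in simp)
  then have "eigenvalue M \<mu>"
    using v M by (auto simp: eigenvalue_def eigenvector_def)
  then show ?thesis using mu by (rule that)
qed

section \<open>Extreme eigenvalues and bounds on the quadratic form\<close>

lemma eigenvalue_rayleigh: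
  fixes M :: "real mat"
  assumes M: "M \<in> carrier_mat n n" and "eigenvalue M \<mu>"
  obtains v where "v \<in> carrier_vec n" "0 < v \<bullet> v" "v \<bullet> (M *\<^sub>v v) = \<mu> * (v \<bullet> v)"
proof -
  obtain v where v: "v \<in> carrier_vec n" "v \<noteq> 0\<^sub>v n" "M *\<^sub>v v = \<mu> \<cdot>\<^sub>v v"
    using assms by (auto simp: eigenvalue_def eigenvector_def)
  show ?thesis
    by (rule that[of v]) (use v scalar_prod_self_pos[of v n] in simp_all)
qed

lemma finite_spectrum_real: "(M :: real mat) \<in> carrier_mat n n \<Longrightarrow> finite (spectrum M)"
  by (rule card_finite_spectrum)

text \<open>The minimum of the Rayleigh quotient is itself in the spectrum, hence at least the
  smallest eigenvalue. Positivity comes from testing the form on an eigenvector for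
  \<open>lambda_min M\<close>.\<close>

lemma lambda_min_quadratic_form:
  assumes spd: "sym_pos_def n M" and n: "0 < n"
  shows "0 < lambda_min M"
    and "v \<in> carrier_vec n \<Longrightarrow> lambda_min M * (v \<bullet> v) \<le> v \<bullet> (M *\<^sub>v v)"
proof -
  have M: "M \<in> carrier_mat n n" "M\<^sup>T = M" using spd by (auto simp: sym_pos_def_def)
  note fin = finite_spectrum_real[OF M(1)]
  obtain \<mu> where \<mu>: "eigenvalue M \<mu>" "\<And>v. v \<in> carrier_vec n \<Longrightarrow> \<mu> * (v \<bullet> v) \<le> v \<bullet> (M *\<^sub>v v)"
    using rayleigh_minimum_eigenvalue[OF M n] by blast
  then have mem: "\<mu> \<in> spectrum M" by (simp add: spectrum_def)
  then have "lambda_min M \<in> spectrum M"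
    using fin by (auto simp: lambda_min_def intro: Min_in)
  then obtain v where v: "v \<in> carrier_vec n" "0 < v \<bullet> v" "v \<bullet> (M *\<^sub>v v) = lambda_min M * (v \<bullet> v)"
    using eigenvalue_rayleigh[OF M(1), of "lambda_min M"] by (auto simp: spectrum_def)
  then have "v \<noteq> 0\<^sub>v n" by auto
  then have "0 < lambda_min M * (v \<bullet> v)" using spd v by (auto simp: sym_pos_def_def)
  then show "0 < lambda_min M" using v(2) by (simp add: zero_less_mult_iff)
  have "lambda_min M \<le> \<mu>" using fin mem by (simp add: lambda_min_def)
  then show "lambda_min M * (v \<bullet> v) \<le> v \<bullet> (M *\<^sub>v v)" if "v \<in> carrier_vec n" for v
    using \<mu>(2)[OF that] mult_right_mono[OF _ scalar_prod_self_nonneg[of v]] by fastforce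
qed

text \<open>Every eigenvalue is a Rayleigh quotient and so lies between \<open>a\<close> and
  \<open>b\<close>. With \<open>0 < n\<close> the spectrum is nonempty, so its \<open>Min\<close>
  and \<open>Max\<close> are eigenvalues.\<close>

lemma cond_number_le:
  fixes M :: "real mat"
  assumes M: "M \<in> carrier_mat n n" "M\<^sup>T = M" and n: "0 < n" and a: "0 < a"
    and lower: "\<And>v. v \<in> carrier_vec n \<Longrightarrow> a * (v \<bullet> v) \<le> v \<bullet> (M *\<^sub>v v)"
    and upper: "\<And>v. v \<in> carrier_vec n \<Longrightarrow> v \<bullet> (M *\<^sub>v v) \<le> b * (v \<bullet> v)"
  shows "cond_number M \<le> b / a"
proof -
  have bounds: "a \<le> \<mu> \<and> \<mu> \<le> b" if mem: "\<mu> \<in> spectrum M" for \<mu>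
  proof -
    from mem have "eigenvalue M \<mu>" by (simp add: spectrum_def)
    then obtain v where v: "v \<in> carrier_vec n" "0 < v \<bullet> v" "v \<bullet> (M *\<^sub>v v) = \<mu> * (v \<bullet> v)"
      using eigenvalue_rayleigh[OF M(1)] by blast
    then show ?thesis using lower[OF v(1)] upper[OF v(1)] by simp
  qed
  note fin = finite_spectrum_real[OF M(1)]
  obtain \<mu> where "eigenvalue M \<mu>"
    using rayleigh_minimum_eigenvalue[OF M n] by blast
  then have ne: "spectrum M \<noteq> {}" by (auto simp: spectrum_def)
  have "a \<le> lambda_min M" "0 \<le> lambda_max M" "lambda_max M \<le> b"
    using bounds[OF Min_in[OF fin ne]] bounds[OF Max_in[OF fin ne]] a
    by (auto simp: lambda_min_def lambda_max_def)
  then show ?thesis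
    unfolding cond_number_def using a by (intro frac_le) auto
qed

text \<open>With \<open>y = P x\<close>, the bound on \<open>M\<close> gives
  \<open>l * (y \<bullet> y) \<le> x \<bullet> y\<close>, and Cauchy-Schwarz bounds the square of
  \<open>x \<bullet> y\<close> by \<open>(x \<bullet> x) * (y \<bullet> y)\<close>. Eliminating
  \<open>y \<bullet> y\<close> leaves one factor \<open>x \<bullet> y\<close> to cancel.\<close>

lemma inverse_form_upper_bound:
  fixes M P :: "real mat"
  assumes M: "M \<in> carrier_mat n n" and P: "P \<in> carrier_mat n n" "M * P = 1\<^sub>m n"
    and l: "0 < l" "\<And>v. v \<in> carrier_vec n \<Longrightarrow> l * (v \<bullet> v) \<le> v \<bullet> (M *\<^sub>v v)"
    and x: "x \<in> carrier_vec n"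
  shows "x \<bullet> (P *\<^sub>v x) \<le> (x \<bullet> x) / l"
proof -
  define y where "y = P *\<^sub>v x"
  have y: "y \<in> carrier_vec n" using P x by (simp add: y_def)
  have My: "M *\<^sub>v y = x" using M P x by (simp add: y_def flip: assoc_mult_mat_vec)
  have nn: "0 \<le> v \<bullet> (1\<^sub>m n *\<^sub>v v)" if "v \<in> carrier_vec n" for v :: "real vec"
    using that by (simp add: scalar_prod_self_nonneg)
  have "(x \<bullet> y)\<^sup>2 \<le> (x \<bullet> x) * (y \<bullet> y)"
    using psd_cauchy_schwarz[OF one_carrier_mat transpose_one nn x y] x y by simp
  moreover have xy: "l * (y \<bullet> y) \<le> x \<bullet> y"
    using l(2)[OF y] comm_scalar_prod[OF y x] by (simp add: My)
  ultimately have "l * (x \<bullet> y)\<^sup>2 \<le> (x \<bullet> x) * (x \<bullet> y)"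
    using l(1) scalar_prod_self_nonneg[of x]
    by (smt (verit) mult_left_mono mult.left_commute)
  then have *: "(l * (x \<bullet> y)) * (x \<bullet> y) \<le> (x \<bullet> x) * (x \<bullet> y)"
    by (simp add: power2_eq_square mult.assoc)
  have "l * (x \<bullet> y) \<le> x \<bullet> x"
  proof (cases "x \<bullet> y = 0")
    case False
    moreover have "0 \<le> l * (y \<bullet> y)" using l(1) scalar_prod_self_nonneg[of y] by simp
    ultimately have "0 < x \<bullet> y" using xy by linarith
    with * show ?thesis by simp
  qed (simp add: scalar_prod_self_nonneg)
  then show ?thesis using l(1) by (simp add: y_def field_simps)
qed

section \<open>Orthonormal congruences and the Schur complement\<close>

text \<open>In this and the next two rules the premises are equations between dimensions, so
  rewriting need not guess the sizes that carrier premises would leave free.\<close>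

lemma mult_mat_assoc:
  "dim_col A = dim_row B \<Longrightarrow> dim_col B = dim_row C \<Longrightarrow> (A * B) * C = A * (B * (C :: real mat))"
  by (rule assoc_mult_mat) auto

lemma mult_mat_vec_assoc:
  "dim_col A = dim_row B \<Longrightarrow> dim_col B = dim_vec v \<Longrightarrow> (A * B) *\<^sub>v v = A *\<^sub>v (B *\<^sub>v (v :: real vec))"
  by (rule assoc_mult_mat_vec) auto

lemma transpose_mult_dim:
  "dim_col A = dim_row B \<Longrightarrow> (A * B)\<^sup>T = B\<^sup>T * (A :: real mat)\<^sup>T"
  by (rule transpose_mult) auto

lemma congruence_form:
  fixes M P :: "real mat"
  assumes M: "M \<in> carrier_mat n n" and P: "P \<in> carrier_mat m n" and y: "y \<in> carrier_vec m"
  shows "y \<bullet> ((P * M * P\<^sup>T) *\<^sub>v y) = (P\<^sup>T *\<^sub>v y) \<bullet> (M *\<^sub>v (P\<^sup>T *\<^sub>v y))"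
proof -
  have "(P * M * P\<^sup>T) *\<^sub>v y = P *\<^sub>v (M *\<^sub>v (P\<^sup>T *\<^sub>v y))"
    using M P y by (simp add: mult_mat_vec_assoc)
  then show ?thesis
    using transpose_vec_mult_scalar[OF P _ y, of "M *\<^sub>v (P\<^sup>T *\<^sub>v y)"] M P y by simp
qed

lemma orthonormal_rows_isometry:
  fixes P :: "real mat"
  assumes P: "P \<in> carrier_mat m n" "P * P\<^sup>T = 1\<^sub>m m" and y: "y \<in> carrier_vec m"
  shows "(P\<^sup>T *\<^sub>v y) \<bullet> (P\<^sup>T *\<^sub>v y) = y \<bullet> y"
  using congruence_form[OF one_carrier_mat P(1) y] P y by simp

text \<open>Orthonormal rows make \<open>P\<^sup>T\<close> an isometry, hence injective, so
  positivity survives the compression. This serves both \<open>\<Theta> k\<close> and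
  \<open>B k\<close>.\<close>

lemma congruence_sym_pos_def:
  assumes M: "sym_pos_def n M" and P: "P \<in> carrier_mat m n" "P * P\<^sup>T = 1\<^sub>m m"
  shows "sym_pos_def m (P * M * P\<^sup>T)"
  unfolding sym_pos_def_def
proof (intro conjI ballI impI)
  have Mc: "M \<in> carrier_mat n n" "M\<^sup>T = M" using M by (auto simp: sym_pos_def_def)
  show "P * M * P\<^sup>T \<in> carrier_mat m m" using Mc P by simp
  have "(P * M * P\<^sup>T)\<^sup>T = P * (M * P\<^sup>T)"
    using Mc P by (simp add: transpose_mult_dim mult_mat_assoc)
  then show "(P * M * P\<^sup>T)\<^sup>T = P * M * P\<^sup>T"
    using Mc P by (simp add: mult_mat_assoc)
  fix y :: "real vec" assume y: "y \<in> carrier_vec m" "y \<noteq> 0\<^sub>v m"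
  have "0 < (P\<^sup>T *\<^sub>v y) \<bullet> (P\<^sup>T *\<^sub>v y)"
    using orthonormal_rows_isometry[OF P y(1)] scalar_prod_self_pos[OF y] by simp
  then have "P\<^sup>T *\<^sub>v y \<noteq> 0\<^sub>v n" by auto
  then have "0 < (P\<^sup>T *\<^sub>v y) \<bullet> (M *\<^sub>v (P\<^sup>T *\<^sub>v y))"
    using M P y by (simp add: sym_pos_def_def)
  then show "0 < y \<bullet> ((P * M * P\<^sup>T) *\<^sub>v y)"
    using congruence_form[OF Mc(1) P(1) y(1)] by simp
qed

text \<open>The rows of \<open>P\<close> and \<open>W\<close> together form an orthonormal basis.
  The projection \<open>E = 1 - P\<^sup>T * P\<close> maps into the kernel of \<open>P\<close>,
  which is the image of \<open>W\<^sup>T\<close>, and \<open>W * E = W\<close> then forces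
  \<open>E = W\<^sup>T * W\<close>.\<close>

lemma orthogonal_complement_decomposition:
  fixes P W :: "real mat"
  assumes P: "P \<in> carrier_mat s m" "P * P\<^sup>T = 1\<^sub>m s"
    and W: "W \<in> carrier_mat r m" "W * W\<^sup>T = 1\<^sub>m r"
    and im: "mat_image W\<^sup>T = mat_kernel P"
  shows "P * W\<^sup>T = 0\<^sub>m s r" "W * P\<^sup>T = 0\<^sub>m r s" "P\<^sup>T * P = 1\<^sub>m m - W\<^sup>T * W"
proof -
  show PW: "P * W\<^sup>T = 0\<^sub>m s r"
  proof (rule mat_col_eqI)
    fix j assume "j < dim_col (0\<^sub>m s r :: real mat)"
    then have j: "j < r" by simp
    have u: "W\<^sup>T *\<^sub>v unit_vec r j = col W\<^sup>T j"
      using W j by (intro eq_vecI) auto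
    have "W\<^sup>T *\<^sub>v unit_vec r j \<in> mat_image W\<^sup>T" using W j by (auto simp: mat_image_def)
    moreover have "col (P * W\<^sup>T) j = P *\<^sub>v (W\<^sup>T *\<^sub>v unit_vec r j)"
      unfolding u using P W j by (intro col_mult2) auto
    ultimately show "col (P * W\<^sup>T) j = col (0\<^sub>m s r) j"
      using P im j by (auto simp: mat_kernel_def)
  qed (use P W in auto)
  have "W * P\<^sup>T = (P * W\<^sup>T)\<^sup>T" using P W by (simp add: transpose_mult_dim)
  then show WP: "W * P\<^sup>T = 0\<^sub>m r s" by (simp add: PW)
  define E where "E = 1\<^sub>m m - P\<^sup>T * P"
  have E: "E \<in> carrier_mat m m" using P by (auto simp: E_def)
  have "P * (P\<^sup>T * P) = P" "W * (P\<^sup>T * P) = 0\<^sub>m r m"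
    using P W WP by (simp_all flip: mult_mat_assoc)
  then have PE: "P * E = 0\<^sub>m s m" and WE: "W * E = W"
    using P W by (auto simp: E_def mult_minus_distrib_mat[of _ _ m _ m])
  have "E = W\<^sup>T * W"
  proof (rule mat_col_eqI)
    fix j assume "j < dim_col (W\<^sup>T * W)"
    then have j: "j < m" using W by simp
    have c: "col E j \<in> carrier_vec m" using E by auto
    have "P *\<^sub>v col E j = 0\<^sub>v s"
      using PE col_mult2[OF P(1) E j] j by simp
    then have "col E j \<in> mat_image W\<^sup>T" unfolding im using P c by (auto simp: mat_kernel_def)
    then obtain y where y: "y \<in> carrier_vec r" "col E j = W\<^sup>T *\<^sub>v y"
      using W by (auto simp: mat_image_def)
    \<comment> \<open>Applying \<open>W\<close> recovers the coefficient vector \<open>y\<close>,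
      because \<open>W * W\<^sup>T\<close> is the identity.\<close>
    have "col W j = W *\<^sub>v col E j" using WE col_mult2[OF W(1) E j] by simp
    also have "\<dots> = y" using y W by (simp flip: assoc_mult_mat_vec)
    finally show "col E j = col (W\<^sup>T * W) j"
      using y W j by (subst col_mult2[of _ m r _ m]) auto
  qed (use E W in auto)
  moreover have "P\<^sup>T * P = 1\<^sub>m m - E"
    using P by (intro eq_matI) (auto simp: E_def)
  ultimately show "P\<^sup>T * P = 1\<^sub>m m - W\<^sup>T * W" by simp
qed

text \<open>One step of the transform is the Schur complement of the block \<open>B\<close> in the orthonormal basis
  formed by the rows of \<open>P\<close> and \<open>W\<close>; its inverse is the block \<open>P * T * P\<^sup>T\<close> of the inverse.\<close>

lemma gamblet_step_inverse:
  fixes A T P W B Bi N R :: "real mat"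
  assumes A: "A \<in> carrier_mat m m" "A\<^sup>T = A" and T: "T \<in> carrier_mat m m" "A * T = 1\<^sub>m m"
    and P: "P \<in> carrier_mat s m" "P * P\<^sup>T = 1\<^sub>m s"
    and W: "W \<in> carrier_mat r m" "W * W\<^sup>T = 1\<^sub>m r"
    and im: "mat_image W\<^sup>T = mat_kernel P"
    and Bi: "Bi \<in> carrier_mat r r" "Bi * (W * A * W\<^sup>T) = 1\<^sub>m r" "Bi\<^sup>T = Bi"
    and N: "N = A * W\<^sup>T * Bi" and R: "R = P * (1\<^sub>m m - N * W)"
  shows "(R * A * R\<^sup>T) * (P * T * P\<^sup>T) = 1\<^sub>m s"
proof -
  note PW = orthogonal_complement_decomposition[OF P W im]
  define G where "G = 1\<^sub>m m - N * W"
  have Nc: "N \<in> carrier_mat m r" using A W Bi by (simp add: N)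
  have G: "G \<in> carrier_mat m m" using Nc W by (auto simp: G_def)
  note dims = carrier_matD[OF A(1)] carrier_matD[OF T(1)] carrier_matD[OF P(1)]
    carrier_matD[OF W(1)] carrier_matD[OF Bi(1)] carrier_matD[OF Nc] carrier_matD[OF G]
  \<comment> \<open>\<open>Bi\<close> inverts \<open>W * A * W\<^sup>T\<close>, so \<open>G\<close>
    annihilates \<open>A * W\<^sup>T\<close>. This removes the correction term of
    \<open>G\<^sup>T\<close> and later the \<open>W\<close> part of
    \<open>P\<^sup>T * P\<close>.\<close>
  have "N * W * (A * W\<^sup>T) = A * W\<^sup>T * (Bi * (W * A * W\<^sup>T))"
    by (simp add: N mult_mat_assoc dims)
  also have "\<dots> = A * W\<^sup>T" unfolding Bi(2) using A W by simp
  finally have GAW: "G * (A * W\<^sup>T) = 0\<^sub>m m r"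
    using A W Nc by (simp add: G_def minus_mult_distrib_mat[of _ m m _ _ r])
  have "(N * W)\<^sup>T = W\<^sup>T * (Bi * (W * A))"
    using A W Bi by (simp add: N transpose_mult_dim mult_mat_assoc)
  then have GT: "G\<^sup>T = 1\<^sub>m m - W\<^sup>T * (Bi * (W * A))"
    using Nc W by (simp add: G_def transpose_minus[of _ m m])
  have "G * A * G\<^sup>T = G * A - G * A * (W\<^sup>T * (Bi * (W * A)))"
    using A G W Bi by (simp add: GT mult_minus_distrib_mat[of _ m m _ m])
  also have "G * A * (W\<^sup>T * (Bi * (W * A))) = G * (A * W\<^sup>T) * (Bi * (W * A))"
    by (simp add: mult_mat_assoc dims)
  also have "\<dots> = 0\<^sub>m m m" using A W Bi by (simp add: GAW)
  finally have GAG: "G * A * G\<^sup>T = G * A" using A G by auto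
  have "R\<^sup>T = G\<^sup>T * P\<^sup>T" using P G by (simp add: R G_def[symmetric] transpose_mult_dim)
  \<comment> \<open>The inner \<open>P\<^sup>T * P\<close> acts as the identity next to
    \<open>G * A\<close>, which brings \<open>A * T = 1\<close> together; finally
    \<open>W * P\<^sup>T = 0\<close> makes \<open>G\<close> fix \<open>P\<^sup>T\<close>.\<close>
  then have "(R * A * R\<^sup>T) * (P * T * P\<^sup>T) = P * (G * A * G\<^sup>T) * (P\<^sup>T * P) * (T * P\<^sup>T)"
    by (simp add: R G_def[symmetric] mult_mat_assoc dims)
  also have "\<dots> = P * (G * A * (1\<^sub>m m - W\<^sup>T * W)) * (T * P\<^sup>T)"
    by (simp add: GAG PW(3) mult_mat_assoc dims)
  also have "G * A * (1\<^sub>m m - W\<^sup>T * W) = G * A - G * A * (W\<^sup>T * W)"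
    using A G W by (simp add: mult_minus_distrib_mat[of _ m m _ m])
  also have "G * A * (W\<^sup>T * W) = G * (A * W\<^sup>T) * W" by (simp add: mult_mat_assoc dims)
  also have "\<dots> = 0\<^sub>m m m" using W by (simp add: GAW)
  also have "G * A - 0\<^sub>m m m = G * A" using A G by auto
  also have "P * (G * A) * (T * P\<^sup>T) = P * (G * ((A * T) * P\<^sup>T))"
    by (simp add: mult_mat_assoc dims)
  also have "\<dots> = P * (G * P\<^sup>T)" using P by (simp add: T(2))
  also have "G * P\<^sup>T = P\<^sup>T - N * (W * P\<^sup>T)"
    using P W Nc by (simp add: G_def minus_mult_distrib_mat[of _ m m _ _ s] mult_mat_assoc dims)
  also have "\<dots> = P\<^sup>T" using Nc P by (auto simp: PW(2))
  finally show ?thesis by (simp add: P(2))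
qed

section \<open>Bounds along the gamblet hierarchy\<close>

lemma inv_energy_ratio_square:
  assumes "0 < x \<bullet> x" "0 \<le> x \<bullet> (minv A *\<^sub>v x)"
  shows "(inv_energy_ratio A x)\<^sup>2 = (x \<bullet> (minv A *\<^sub>v x)) / (x \<bullet> x)"
  using assms by (simp add: inv_energy_ratio_def vec_len_def power_divide)

lemma sym_pos_def_form_nonneg:
  assumes "sym_pos_def n M" "v \<in> carrier_vec n"
  shows "0 \<le> v \<bullet> (M *\<^sub>v v)"
proof (cases "v = 0\<^sub>v n")
  case True
  have "M \<in> carrier_mat n n" using assms by (simp add: sym_pos_def_def)
  then show ?thesis using True by simp
next
  case False
  then show ?thesis using assms by (auto simp: sym_pos_def_def intro: less_imp_le)
qed

section \<open>Sizes and orthonormality of the hierarchy matrices\<close>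

lemma index_mat_carrier: "index_mat S T f \<in> carrier_mat (card S) (card T)"
  by (simp add: index_mat_def)

lemma pi_step_carrier: "pi_step I p k \<in> carrier_mat (card (level I k)) (card (level I (k + 1)))"
  by (simp add: pi_step_def index_mat_carrier)

lemma wavelet_mat_carrier: "wavelet_mat I J w k \<in> carrier_mat (card (J k)) (card (level I k))"
  by (simp add: wavelet_mat_def index_mat_carrier)

lemma pi_top_self: "pi_top q I p q = 1\<^sub>m (card (level I q))"
  by (simp add: pi_top_def)

lemma pi_top_step: "k < q \<Longrightarrow> pi_top q I p k = pi_step I p k * pi_top q I p (k + 1)"
  by (simp add: pi_top_def upt_conv_Cons)

lemma pi_top_carrier:
  assumes "k \<le> q"
  shows "pi_top q I p k \<in> carrier_mat (card (level I k)) (card (level I q))"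
  using assms
proof (induction rule: inc_induct)
  case (step k)
  then show ?case
    using mult_carrier_mat[OF pi_step_carrier[of I p k]] by (simp add: pi_top_step)
qed (simp add: pi_top_self)

text \<open>Downward induction from the empty product at \<open>k = q\<close>: the inner factor
  \<open>?P * ?P\<^sup>T\<close> collapses to the identity.\<close>

lemma pi_top_orthonormal:
  assumes o: "orthonormal_pi q I p" and k: "1 \<le> k" "k \<le> q"
  shows "pi_top q I p k * (pi_top q I p k)\<^sup>T = 1\<^sub>m (card (level I k))"
  using k(2,1)
proof (induction rule: inc_induct)
  case (step k)
  let ?p = "pi_step I p k" and ?P = "pi_top q I p (k + 1)"
  have "Suc k \<le> q" using step by simp
  note dims = carrier_matD[OF pi_step_carrier[of I p k]] carrier_matD[OF pi_top_carrier[OF this, of I p]]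
  have "?p * ?P * (?p * ?P)\<^sup>T = ?p * ((?P * ?P\<^sup>T) * ?p\<^sup>T)"
    using dims by (simp add: transpose_mult_dim mult_mat_assoc)
  also have "?P * ?P\<^sup>T = 1\<^sub>m (card (level I (k + 1)))" using step by simp
  also have "?p * (1\<^sub>m (card (level I (k + 1))) * ?p\<^sup>T) = ?p * ?p\<^sup>T"
    using pi_step_carrier[of I p k] by simp
  also have "\<dots> = 1\<^sub>m (card (level I k))"
    using o step by (auto simp: orthonormal_pi_def)
  finally show ?case using step by (simp add: pi_top_step)
qed (simp add: pi_top_self)

lemma level_top:
  assumes "index_tree q n I"
  shows "level I q = I"
proof -
  have "take q i = i" if "i \<in> I" for i using assms that by (simp add: index_tree_def)
  then show ?thesis by (force simp: level_def)
qed

text \<open>Ensures that \<open>A 1\<close> has an eigenvalue, as its condition number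
  requires.\<close>

lemma card_level_pos:
  assumes "index_tree q n I"
  shows "0 < card (level I k)"
proof -
  have "finite I" "I \<noteq> {}" using assms by (auto simp: index_tree_def)
  then show ?thesis by (simp add: level_def card_gt_0_iff)
qed

text \<open>Hypotheses (i) and (ii) stay outside: each bound takes the one inequality it uses, at a
  single level and with an abstract constant \<open>c\<close>.\<close>

locale gamblet_hierarchy =
  fixes q n :: nat and I J p w and A0 :: "real mat" and A B N R
  assumes tree: "index_tree q n I"
    and pi: "orthonormal_pi q I p"
    and wavelets: "orthonormal_wavelets q I J p w"
    and spd: "sym_pos_def n A0"
    and transform: "gamblet_transform q I J p w A0 A B N R"
begin

abbreviation "d k \<equiv> card (level I k)"
abbreviation "P k \<equiv> pi_top q I p k"
abbreviation "W k \<equiv> wavelet_mat I J w k"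
abbreviation "\<Theta> k \<equiv> P k * minv A0 * (P k)\<^sup>T"
abbreviation "lam \<equiv> lambda_min A0"

lemma n_pos: "0 < n"
  using tree by (simp add: index_tree_def)

lemma d_top: "d q = n"
  using tree by (simp add: level_top[OF tree] index_tree_def)

lemma P_carrier: "k \<le> q \<Longrightarrow> P k \<in> carrier_mat (d k) n"
  using pi_top_carrier[of k q I p] by (simp add: d_top)

lemmas A0_inverse = sym_pos_def_minv[OF spd]

lemma A0_carrier: "A0 \<in> carrier_mat n n"
  using spd by (simp add: sym_pos_def_def)

lemma minv_spd: "sym_pos_def n (minv A0)"
  using inverse_sym_pos_def[OF spd A0_inverse(1,2)] .

lemmas lam_pos = lambda_min_quadratic_form(1)[OF spd n_pos]

lemma \<Theta>_spd: "1 \<le> k \<Longrightarrow> k \<le> q \<Longrightarrow> sym_pos_def (d k) (\<Theta> k)"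
  by (rule congruence_sym_pos_def[OF minv_spd P_carrier pi_top_orthonormal[OF pi]])

lemma W_facts:
  assumes "2 \<le> k" "k \<le> q"
  shows "mat_image ((W k)\<^sup>T) = mat_kernel (pi_step I p (k - 1))" "W k * (W k)\<^sup>T = 1\<^sub>m (card (J k))"
  using wavelets assms by (auto simp: orthonormal_wavelets_def)

lemma transform_facts:
  assumes "2 \<le> k" "k \<le> q"
  shows "B k = W k * A k * (W k)\<^sup>T" "N k = A k * (W k)\<^sup>T * minv (B k)"
    "R k = pi_step I p (k - 1) * (1\<^sub>m (d k) - N k * W k)" "A (k - 1) = R k * A k * (R k)\<^sup>T"
  using transform assms by (auto simp: gamblet_transform_def Let_def)

text \<open>The two claims descend together: positive definiteness at the finer level makes
  \<open>B\<close> invertible, so the Schur complement step applies; the resulting inverse relation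
  gives positive definiteness at the coarser level.\<close>

lemma A_inverse_and_spd:
  assumes "1 \<le> k" "k \<le> q"
  shows "sym_pos_def (d k) (A k) \<and> A k * \<Theta> k = 1\<^sub>m (d k)"
  using assms(2,1)
proof (induction rule: inc_induct)
  case base
  have "A q = A0" using transform by (simp add: gamblet_transform_def)
  then show ?case
    using spd A0_inverse by (simp add: pi_top_self d_top)
next
  case (step k)
  let ?k = "Suc k" and ?p = "pi_step I p k"
  have k: "2 \<le> ?k" "?k \<le> q" using step by auto
  have IH: "sym_pos_def (d ?k) (A ?k)" "A ?k * \<Theta> ?k = 1\<^sub>m (d ?k)" using step by auto
  have Ak: "A ?k \<in> carrier_mat (d ?k) (d ?k)" "(A ?k)\<^sup>T = A ?k"
    using IH(1) by (auto simp: sym_pos_def_def)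
  have p: "?p \<in> carrier_mat (d k) (d ?k)" using pi_step_carrier[of I p k] by simp
  have pp: "?p * ?p\<^sup>T = 1\<^sub>m (d k)" using pi step by (auto simp: orthonormal_pi_def)
  note W = W_facts[OF k]
  note tr = transform_facts[OF k]
  have Bs: "sym_pos_def (card (J ?k)) (B ?k)"
    unfolding tr(1) by (rule congruence_sym_pos_def[OF IH(1) wavelet_mat_carrier W(2)])
  note Bi = sym_pos_def_minv[OF Bs]
  have Bit: "(minv (B ?k))\<^sup>T = minv (B ?k)"
    using inverse_sym_pos_def[OF Bs Bi(1,2)] by (simp add: sym_pos_def_def)
  have T: "\<Theta> ?k \<in> carrier_mat (d ?k) (d ?k)" using \<Theta>_spd[of ?k] k by (simp add: sym_pos_def_def)
  have Pk: "P ?k \<in> carrier_mat (d ?k) n" using P_carrier k by simp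
  \<comment> \<open>The block of the inverse in the Schur complement step is exactly the next
    \<open>\<Theta>\<close>.\<close>
  have "?p * \<Theta> ?k * ?p\<^sup>T = \<Theta> k"
    using p Pk A0_inverse(1) step by (simp add: pi_top_step transpose_mult_dim mult_mat_assoc)
  then have AT: "A k * \<Theta> k = 1\<^sub>m (d k)"
    using gamblet_step_inverse[OF Ak T IH(2) p pp wavelet_mat_carrier W(2) _ Bi(1) _ Bit tr(2)] W(1) tr Bi(3)
    by simp
  have Tk: "sym_pos_def (d k) (\<Theta> k)" using \<Theta>_spd step by simp
  have "R ?k \<in> carrier_mat (d k) (d ?k)"
    using p Ak wavelet_mat_carrier[of I J w ?k] Bi(1) by (auto simp: tr(2,3) intro!: mult_carrier_mat[of _ _ "d ?k"])
  then have Ac: "A k \<in> carrier_mat (d k) (d k)"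
    using tr(4) Ak by simp
  \<comment> \<open>For square matrices a one-sided inverse is two-sided; this order presents
    \<open>A k\<close> as the inverse of the positive definite \<open>\<Theta> k\<close>.\<close>
  have "\<Theta> k * A k = 1\<^sub>m (d k)"
    by (rule mat_mult_left_right_inverse[OF Ac _ AT]) (use Tk in \<open>simp add: sym_pos_def_def\<close>)
  then show ?case using inverse_sym_pos_def[OF Tk Ac] AT by simp
qed

lemma A_spd: "1 \<le> k \<Longrightarrow> k \<le> q \<Longrightarrow> sym_pos_def (d k) (A k)"
  and A_\<Theta>: "1 \<le> k \<Longrightarrow> k \<le> q \<Longrightarrow> A k * \<Theta> k = 1\<^sub>m (d k)"
  using A_inverse_and_spd by auto

lemma A_carrier: "1 \<le> k \<Longrightarrow> k \<le> q \<Longrightarrow> A k \<in> carrier_mat (d k) (d k)"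
  and A_sym: "1 \<le> k \<Longrightarrow> k \<le> q \<Longrightarrow> (A k)\<^sup>T = A k"
  using A_spd by (auto simp: sym_pos_def_def)

lemma \<Theta>_carrier: "1 \<le> k \<Longrightarrow> k \<le> q \<Longrightarrow> \<Theta> k \<in> carrier_mat (d k) (d k)"
  using \<Theta>_spd by (auto simp: sym_pos_def_def)

lemma \<Theta>_A: "1 \<le> k \<Longrightarrow> k \<le> q \<Longrightarrow> \<Theta> k * A k = 1\<^sub>m (d k)"
  by (rule mat_mult_left_right_inverse[OF A_carrier \<Theta>_carrier A_\<Theta>])

section \<open>From the energy-ratio hypotheses to bounds on \<open>A k\<close>\<close>

lemma minv_form_le: "x \<in> carrier_vec n \<Longrightarrow> x \<bullet> (minv A0 *\<^sub>v x) \<le> (x \<bullet> x) / lam"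
  by (rule inverse_form_upper_bound[OF A0_carrier A0_inverse(1,2) lam_pos
        lambda_min_quadratic_form(2)[OF spd n_pos]])

text \<open>This bound and the next make the ratios a bounded set, without which a real
  \<open>INF\<close> or \<open>SUP\<close> could not be compared with its members.\<close>

lemma ratio_nonneg: "x \<in> carrier_vec n \<Longrightarrow> 0 \<le> inv_energy_ratio A0 x"
  using sym_pos_def_form_nonneg[OF minv_spd, of x] scalar_prod_self_nonneg[of x]
  by (simp add: inv_energy_ratio_def vec_len_def)

lemma ratio_le:
  assumes "x \<in> carrier_vec n" "x \<noteq> 0\<^sub>v n"
  shows "inv_energy_ratio A0 x \<le> sqrt (1 / lam)"
proof (rule real_le_rsqrt)
  have pos: "0 < x \<bullet> x" by (rule scalar_prod_self_pos[OF assms])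
  then show "(inv_energy_ratio A0 x)\<^sup>2 \<le> 1 / lam"
    using minv_form_le[OF assms(1)] sym_pos_def_form_nonneg[OF minv_spd assms(1)] lam_pos
    by (simp add: inv_energy_ratio_square field_simps)
qed

text \<open>Hypothesis (i) as an inequality of forms: with \<open>0 \<le> c\<close> the ratio bound
  may be squared, and the excluded zero vector is trivial.\<close>

lemma minv_form_lower:
  assumes S: "S \<subseteq> carrier_vec n" and c: "0 \<le> c"
    and inf: "c \<le> (INF x \<in> S - {0\<^sub>v n}. inv_energy_ratio A0 x)" and x: "x \<in> S"
  shows "c\<^sup>2 * (x \<bullet> x) \<le> x \<bullet> (minv A0 *\<^sub>v x)"
proof (cases "x = 0\<^sub>v n")
  case True
  then show ?thesis using A0_inverse(1) by simp
next
  case False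
  have xc: "x \<in> carrier_vec n" using S x by blast
  have pos: "0 < x \<bullet> x" by (rule scalar_prod_self_pos[OF xc False])
  have "(INF x \<in> S - {0\<^sub>v n}. inv_energy_ratio A0 x) \<le> inv_energy_ratio A0 x"
    using x False S by (intro cINF_lower bdd_belowI2[of _ 0]) (auto intro: ratio_nonneg)
  then have "c \<le> inv_energy_ratio A0 x" using inf by simp
  then have "c\<^sup>2 \<le> (inv_energy_ratio A0 x)\<^sup>2" using c by (rule power_mono)
  then show ?thesis
    using pos sym_pos_def_form_nonneg[OF minv_spd xc] by (simp add: inv_energy_ratio_square field_simps)
qed

lemma minv_form_upper:
  assumes S: "S \<subseteq> carrier_vec n"
    and sup: "(SUP x \<in> S - {0\<^sub>v n}. inv_energy_ratio A0 x) \<le> c" and x: "x \<in> S"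
  shows "x \<bullet> (minv A0 *\<^sub>v x) \<le> c\<^sup>2 * (x \<bullet> x)"
proof (cases "x = 0\<^sub>v n")
  case True
  then show ?thesis using A0_inverse(1) by simp
next
  case False
  have xc: "x \<in> carrier_vec n" using S x by blast
  have pos: "0 < x \<bullet> x" by (rule scalar_prod_self_pos[OF xc False])
  have "inv_energy_ratio A0 x \<le> (SUP x \<in> S - {0\<^sub>v n}. inv_energy_ratio A0 x)"
    using x False S by (intro cSUP_upper bdd_aboveI2[of _ _ "sqrt (1 / lam)"]) (auto intro: ratio_le)
  then have "inv_energy_ratio A0 x \<le> c" using sup by simp
  then have "(inv_energy_ratio A0 x)\<^sup>2 \<le> c\<^sup>2" using ratio_nonneg[OF xc] by (intro power_mono)
  then show ?thesis
    using pos sym_pos_def_form_nonneg[OF minv_spd xc] by (simp add: inv_energy_ratio_square field_simps)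
qed

text \<open>The hypotheses concern vectors at the finest level; the isometry
  \<open>(P k)\<^sup>T\<close> carries them to level \<open>k\<close> without changing
  lengths.\<close>

lemma \<Theta>_form:
  assumes k: "1 \<le> k" "k \<le> q" and y: "y \<in> carrier_vec (d k)"
  shows "y \<bullet> (\<Theta> k *\<^sub>v y) = ((P k)\<^sup>T *\<^sub>v y) \<bullet> (minv A0 *\<^sub>v ((P k)\<^sup>T *\<^sub>v y))"
    and "((P k)\<^sup>T *\<^sub>v y) \<bullet> ((P k)\<^sup>T *\<^sub>v y) = y \<bullet> y"
    and "(P k)\<^sup>T *\<^sub>v y \<in> carrier_vec n"
  using congruence_form[OF A0_inverse(1) P_carrier y] P_carrier[of k]
    orthonormal_rows_isometry[OF P_carrier pi_top_orthonormal[OF pi] y] k y by auto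

text \<open>The bound on \<open>\<Theta> k\<close> is assumed at the single vector \<open>y\<close>,
  because for \<open>B k\<close> it is known only on the image of
  \<open>(W k)\<^sup>T\<close>.\<close>

lemma inverse_pair_form_lower:
  assumes k: "1 \<le> k" "k \<le> q" and y: "y \<in> carrier_vec (d k)"
    and le: "y \<bullet> (\<Theta> k *\<^sub>v y) \<le> b * (y \<bullet> y)" and b: "0 < b"
  shows "(y \<bullet> y) / b \<le> y \<bullet> (A k *\<^sub>v y)"
proof (cases "y = 0\<^sub>v (d k)")
  case True
  then show ?thesis using A_carrier[OF k] by simp
next
  case False
  have pos: "0 < y \<bullet> y" by (rule scalar_prod_self_pos[OF y False])
  have "(y \<bullet> y)\<^sup>2 \<le> (y \<bullet> (A k *\<^sub>v y)) * (y \<bullet> (\<Theta> k *\<^sub>v y))"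
    using k y by (intro inverse_form_lower_bound[OF A_carrier A_sym _ \<Theta>_carrier A_\<Theta>]
        sym_pos_def_form_nonneg[OF A_spd]) auto
  also have "\<dots> \<le> (y \<bullet> (A k *\<^sub>v y)) * (b * (y \<bullet> y))"
    by (intro mult_left_mono le sym_pos_def_form_nonneg[OF A_spd[OF k] y])
  finally have "(y \<bullet> y) * (y \<bullet> y) \<le> (b * (y \<bullet> (A k *\<^sub>v y))) * (y \<bullet> y)"
    by (simp add: power2_eq_square ac_simps)
  then show ?thesis using pos b by (simp add: field_simps)
qed

lemma A_lower:
  assumes k: "1 \<le> k" "k \<le> q" and y: "y \<in> carrier_vec (d k)"
  shows "lam * (y \<bullet> y) \<le> y \<bullet> (A k *\<^sub>v y)"
  using inverse_pair_form_lower[OF k y, of "1 / lam"] minv_form_le[of "(P k)\<^sup>T *\<^sub>v y"] \<Theta>_form[OF k y] lam_pos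
  by (simp add: mult.commute)

text \<open>Hypothesis (i) bounds \<open>\<Theta> k\<close> below by the square of \<open>c\<close>,
  and \<open>A k\<close> is its inverse.\<close>

lemma A_upper:
  assumes k: "1 \<le> k" "k \<le> q" and c: "0 < c"
    and inf: "c \<le> (INF x \<in> mat_image ((P k)\<^sup>T) - {0\<^sub>v n}. inv_energy_ratio A0 x)"
    and y: "y \<in> carrier_vec (d k)"
  shows "y \<bullet> (A k *\<^sub>v y) \<le> (y \<bullet> y) / c\<^sup>2"
proof (rule inverse_form_upper_bound[OF \<Theta>_carrier[OF k] A_carrier[OF k] \<Theta>_A[OF k] _ _ y])
  fix v :: "real vec" assume v: "v \<in> carrier_vec (d k)"
  have "mat_image ((P k)\<^sup>T) \<subseteq> carrier_vec n" "(P k)\<^sup>T *\<^sub>v v \<in> mat_image ((P k)\<^sup>T)"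
    using P_carrier[of k] k v by (auto simp: mat_image_def)
  then show "c\<^sup>2 * (v \<bullet> v) \<le> v \<bullet> (\<Theta> k *\<^sub>v v)"
    using minv_form_lower[OF _ less_imp_le[OF c] inf] \<Theta>_form[OF k v] by metis
qed (use c in simp)

section \<open>Bounds on the blocks \<open>B k\<close>\<close>

lemma B_sym_carrier:
  assumes "2 \<le> k" "k \<le> q"
  shows "B k \<in> carrier_mat (card (J k)) (card (J k))" "(B k)\<^sup>T = B k"
  using congruence_sym_pos_def[OF A_spd wavelet_mat_carrier W_facts(2)[OF assms]] assms
  by (auto simp: transform_facts(1) sym_pos_def_def)

lemma B_form:
  assumes k: "2 \<le> k" "k \<le> q" and y: "y \<in> carrier_vec (card (J k))"
  shows "y \<bullet> (B k *\<^sub>v y) = ((W k)\<^sup>T *\<^sub>v y) \<bullet> (A k *\<^sub>v ((W k)\<^sup>T *\<^sub>v y))"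
    and "((W k)\<^sup>T *\<^sub>v y) \<bullet> ((W k)\<^sup>T *\<^sub>v y) = y \<bullet> y"
    and "(W k)\<^sup>T *\<^sub>v y \<in> carrier_vec (d k)"
  using congruence_form[OF A_carrier[of k] wavelet_mat_carrier[of I J w k] y] wavelet_mat_carrier[of I J w k]
    orthonormal_rows_isometry[OF wavelet_mat_carrier[of I J w k] W_facts(2) y] k y
  by (auto simp: transform_facts(1))

lemma B_upper:
  assumes k: "2 \<le> k" "k \<le> q" and c: "0 < c"
    and inf: "c \<le> (INF x \<in> mat_image ((P k)\<^sup>T) - {0\<^sub>v n}. inv_energy_ratio A0 x)"
    and y: "y \<in> carrier_vec (card (J k))"
  shows "y \<bullet> (B k *\<^sub>v y) \<le> (y \<bullet> y) / c\<^sup>2"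
  using A_upper[OF _ k(2) c inf B_form(3)[OF k y]] B_form[OF k y] k by simp

text \<open>The supremum belongs to level \<open>k - 1\<close>, which is the source of the exponent
  \<open>2 * (k - 1)\<close> in the final lower bound.\<close>

lemma B_lower:
  assumes k: "2 \<le> k" "k \<le> q" and c: "0 < c"
    and sup: "(SUP x \<in> mat_kernel (P (k - 1)) - {0\<^sub>v n}. inv_energy_ratio A0 x) \<le> c"
    and y: "y \<in> carrier_vec (card (J k))"
  shows "(y \<bullet> y) / c\<^sup>2 \<le> y \<bullet> (B k *\<^sub>v y)"
proof -
  define z where "z = (W k)\<^sup>T *\<^sub>v y"
  note B = B_form[OF k y, folded z_def]
  let ?p = "pi_step I p (k - 1)"
  have k1: "1 \<le> k" "k - 1 < q" "k - 1 \<le> q" "k - 1 + 1 = k" using k by auto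
  have p: "?p \<in> carrier_mat (d (k - 1)) (d k)" using pi_step_carrier[of I p "k - 1"] k1 by simp
  have Pc: "P k \<in> carrier_mat (d k) n" "P (k - 1) \<in> carrier_mat (d (k - 1)) n"
    using P_carrier k k1 by auto
  have "z \<in> mat_image ((W k)\<^sup>T)"
    using y wavelet_mat_carrier[of I J w k] by (auto simp: z_def mat_image_def)
  then have pz: "?p *\<^sub>v z = 0\<^sub>v (d (k - 1))"
    using W_facts(1)[OF k] p by (auto simp: mat_kernel_def)
  have "P (k - 1) = ?p * P k" using pi_top_step[OF k1(2), of I p] unfolding k1(4) .
  \<comment> \<open>Lifting \<open>z\<close> to the finest level and projecting to level
    \<open>k - 1\<close> amounts to \<open>?p *\<^sub>v z\<close>, which vanishes since
    \<open>z\<close> lies in the image of \<open>(W k)\<^sup>T\<close>.\<close>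
  then have "P (k - 1) *\<^sub>v ((P k)\<^sup>T *\<^sub>v z) = ?p *\<^sub>v ((P k * (P k)\<^sup>T) *\<^sub>v z)"
    using p Pc B(3) k1 by (simp add: mult_mat_vec_assoc)
  also have "\<dots> = 0\<^sub>v (d (k - 1))"
    unfolding pi_top_orthonormal[OF pi k1(1) k(2)] using B(3) pz by simp
  finally have mem: "(P k)\<^sup>T *\<^sub>v z \<in> mat_kernel (P (k - 1))"
    using Pc B(3) by (auto simp: mat_kernel_def)
  have "z \<bullet> (\<Theta> k *\<^sub>v z) \<le> c\<^sup>2 * (z \<bullet> z)"
    using minv_form_upper[OF mat_kernel_carrier[OF Pc(2)] sup mem] \<Theta>_form[OF k1(1) k(2) B(3)] by simp
  from inverse_pair_form_lower[OF k1(1) k(2) B(3) this] c show ?thesis by (simp add: B)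
qed

end

section \<open>Normalisation by the smallest eigenvalue and choice of the constant\<close>

lemma spectrum_dim_0: "M \<in> carrier_mat 0 0 \<Longrightarrow> spectrum M = {}"
  by (auto simp: spectrum_def dest: eigenvalue_imp_nonzero_dim)

lemma scaled_loewner_bounds:
  fixes M :: "real mat"
  assumes M: "M \<in> carrier_mat m m" and l: "0 < l"
  shows "(\<And>v. v \<in> carrier_vec m \<Longrightarrow> l * a * (v \<bullet> v) \<le> v \<bullet> (M *\<^sub>v v)) \<Longrightarrow>
      loewner_le m (a \<cdot>\<^sub>m 1\<^sub>m m) ((1 / l) \<cdot>\<^sub>m M)"
    and "(\<And>v. v \<in> carrier_vec m \<Longrightarrow> v \<bullet> (M *\<^sub>v v) \<le> l * a * (v \<bullet> v)) \<Longrightarrow>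
      loewner_le m ((1 / l) \<cdot>\<^sub>m M) (a \<cdot>\<^sub>m 1\<^sub>m m)"
  using M l by (auto simp: loewner_le_def smult_mat_mult_vec field_simps)

theorem theorem2p9:
  fixes Cd :: real
  assumes "1 \<le> Cd"
  shows "\<exists>C::real. 0 < C \<and>
    (\<forall>(q::nat) (n::nat) I J p w (A0::real mat) (H::real) A B N R.
      index_tree q n I \<longrightarrow>
      orthonormal_pi q I p \<longrightarrow>
      wavelet_index q I J \<longrightarrow>
      orthonormal_wavelets q I J p w \<longrightarrow>
      sym_pos_def n A0 \<longrightarrow>
      gamblet_transform q I J p w A0 A B N R \<longrightarrow>
      0 < H \<longrightarrow> H < 1 \<longrightarrow>
      (\<forall>k\<in>{1..q}.
         1 / (Cd * sqrt (lambda_min A0)) * H ^ k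
         \<le> (INF x \<in> mat_image ((pi_top q I p k)\<^sup>T) - {0\<^sub>v n}. inv_energy_ratio A0 x)) \<longrightarrow>
      (\<forall>k\<in>{1..q - 1}.
         (SUP x \<in> mat_kernel (pi_top q I p k) - {0\<^sub>v n}. inv_energy_ratio A0 x)
         \<le> Cd / sqrt (lambda_min A0) * H ^ k) \<longrightarrow>
      (let m = card (level I 1); A1 = (1 / lambda_min A0) \<cdot>\<^sub>m A 1 in
         loewner_le m ((1 / C) \<cdot>\<^sub>m 1\<^sub>m m) A1 \<and>
         loewner_le m A1 ((C * (1 / H ^ 2)) \<cdot>\<^sub>m 1\<^sub>m m) \<and>
         cond_number (A 1) \<le> C * (1 / H ^ 2)) \<and>
      (\<forall>k\<in>{2..q}.
        let m = card (J k); Bk = (1 / lambda_min A0) \<cdot>\<^sub>m B k in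
         loewner_le m ((1 / C * (1 / H ^ (2 * (k - 1)))) \<cdot>\<^sub>m 1\<^sub>m m) Bk \<and>
         loewner_le m Bk ((C * (1 / H ^ (2 * k))) \<cdot>\<^sub>m 1\<^sub>m m) \<and>
         cond_number (B k) \<le> C * (1 / H ^ 2)))"
proof -
  text \<open>The last summand covers an empty \<open>J k\<close>: the condition number of a \<open>0 \<times> 0\<close> matrix is the
    junk value \<open>Max {} / Min {}\<close>.\<close>
  define C where "C = Cd ^ 4 + \<bar>Max {} / Min {} :: real\<bar>"
  \<comment> \<open>The power \<open>Cd ^ 4\<close> comes from the condition number of
    \<open>B k\<close>, whose upper and lower bounds each contribute \<open>Cd\<^sup>2\<close>; the
    other bounds use \<open>Cd\<^sup>2\<close> alone.\<close>
  have Cd2: "1 \<le> Cd\<^sup>2" and C4: "Cd\<^sup>2 \<le> Cd ^ 4" "Cd ^ 4 \<le> C"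
    using assms by (auto simp: C_def intro: power_increasing)
  then have C: "1 \<le> C" "Cd\<^sup>2 \<le> C" by linarith+
  have Cinv: "1 / C \<le> 1" "1 / C \<le> 1 / Cd\<^sup>2"
    using assms C frac_le[of 1 1 1 C] frac_le[of 1 1 "Cd\<^sup>2" C] by simp_all
  show ?thesis
  proof (intro exI[of _ C], rule conjI, goal_cases)
    case 1
    then show ?case using C by simp
  next
    case 2
    show ?case
    proof (intro allI impI, goal_cases)
      case (1 q n I J p w A0 H A B N R)
      interpret gamblet_hierarchy q n I J p w A0 A B N R
        using 1 by unfold_locales
      note H = \<open>0 < H\<close> \<open>H < 1\<close>
      have q: "1 \<le> q" using tree by (simp add: index_tree_def)
      have H2: "1 \<le> 1 / H\<^sup>2" using H by (simp add: power_le_one)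
      \<comment> \<open>The left side of (i); its inverse square is the upper bound for
        \<open>A k\<close> and \<open>B k\<close>.\<close>
      define a where "a k = 1 / (Cd * sqrt lam) * H ^ k" for k
      have a: "0 < a k" for k using assms lam_pos H by (simp add: a_def)
      have a2: "1 / (a k)\<^sup>2 = lam * (Cd\<^sup>2 * (1 / H ^ (2 * k)))" for k
        using lam_pos by (simp add: a_def power_mult_distrib power_divide mult.commute[of 2] power_mult)
      have up: "r / (a k)\<^sup>2 \<le> lam * (C * (1 / H ^ (2 * k))) * r" if "0 \<le> r" for r k
      proof -
        have "r / (a k)\<^sup>2 = 1 / (a k)\<^sup>2 * r" by simp
        also have "\<dots> \<le> lam * (C * (1 / H ^ (2 * k))) * r"
          unfolding a2 using C lam_pos H that by (intro mult_right_mono mult_left_mono) auto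
        finally show ?thesis .
      qed
      note inf = 1(9)[rule_format, folded a_def]
      have "Cd\<^sup>2 * (1 / H\<^sup>2) \<le> C * (1 / H\<^sup>2)"
        using C H by (intro mult_right_mono) auto
      moreover have "cond_number (A 1) \<le> (1 / (a 1)\<^sup>2) / lam"
        using A_lower[of 1] A_upper[OF _ _ a inf, of 1] q
        by (intro cond_number_le[OF A_carrier A_sym card_level_pos[OF tree] lam_pos]) auto
      ultimately have condA: "cond_number (A 1) \<le> C * (1 / H\<^sup>2)"
        using lam_pos by (simp add: a2)
      have lowA: "lam * (1 / C) * (v \<bullet> v) \<le> v \<bullet> (A 1 *\<^sub>v v)" if v: "v \<in> carrier_vec (d 1)" for v
      proof -
        have "lam * (1 / C) * (v \<bullet> v) \<le> lam * 1 * (v \<bullet> v)"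
          using Cinv lam_pos scalar_prod_self_nonneg[of v] by (intro mult_right_mono mult_left_mono) auto
        with A_lower[OF _ q v] show ?thesis by simp
      qed
      have upA: "v \<bullet> (A 1 *\<^sub>v v) \<le> lam * (C * (1 / H\<^sup>2)) * (v \<bullet> v)" if v: "v \<in> carrier_vec (d 1)" for v
        using A_upper[OF _ q a inf v] up[OF scalar_prod_self_nonneg[of v], of 1] q by simp
      have partA: "loewner_le (d 1) ((1 / C) \<cdot>\<^sub>m 1\<^sub>m (d 1)) ((1 / lam) \<cdot>\<^sub>m A 1)"
        "loewner_le (d 1) ((1 / lam) \<cdot>\<^sub>m A 1) ((C * (1 / H\<^sup>2)) \<cdot>\<^sub>m 1\<^sub>m (d 1))"
        using scaled_loewner_bounds[OF A_carrier lam_pos] q lowA upA by auto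
      have partB: "loewner_le (card (J k)) ((1 / C * (1 / H ^ (2 * (k - 1)))) \<cdot>\<^sub>m 1\<^sub>m (card (J k))) ((1 / lam) \<cdot>\<^sub>m B k) \<and>
           loewner_le (card (J k)) ((1 / lam) \<cdot>\<^sub>m B k) ((C * (1 / H ^ (2 * k))) \<cdot>\<^sub>m 1\<^sub>m (card (J k))) \<and>
           cond_number (B k) \<le> C * (1 / H ^ 2)" if "k \<in> {2..q}" for k
      proof -
        have k: "2 \<le> k" "k \<le> q" using that by auto
        \<comment> \<open>The right side of (ii) at level \<open>k - 1\<close>; its inverse square
          is the lower bound for \<open>B k\<close>.\<close>
        define b where "b = Cd / sqrt lam * H ^ (k - 1)"
        have b: "0 < b" using assms lam_pos H by (simp add: b_def)
        have b2: "1 / b\<^sup>2 = lam * (1 / Cd\<^sup>2 * (1 / H ^ (2 * (k - 1))))"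
          using lam_pos by (simp add: b_def power_mult_distrib power_divide mult.commute[of 2] power_mult)
        have "k - 1 \<in> {1..q - 1}" using k by auto
        note sup = 1(10)[rule_format, OF this, folded b_def]
        have low: "v \<bullet> v / b\<^sup>2 \<le> v \<bullet> (B k *\<^sub>v v)" if "v \<in> carrier_vec (card (J k))" for v
          by (rule B_lower[OF k b sup that])
        have "k \<in> {1..q}" using k by auto
        note upB = B_upper[OF k a inf[OF this]]
        have lowC: "lam * (1 / C * (1 / H ^ (2 * (k - 1)))) * (v \<bullet> v) \<le> v \<bullet> (B k *\<^sub>v v)"
          if v: "v \<in> carrier_vec (card (J k))" for v
        proof -
          have "lam * (1 / C * (1 / H ^ (2 * (k - 1)))) * (v \<bullet> v) \<le> 1 / b\<^sup>2 * (v \<bullet> v)"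
            unfolding b2 using Cinv lam_pos H scalar_prod_self_nonneg[of v]
            by (intro mult_right_mono mult_left_mono) auto
          also have "\<dots> = v \<bullet> v / b\<^sup>2" by simp
          finally show ?thesis using low[OF v] by simp
        qed
        have upC: "v \<bullet> (B k *\<^sub>v v) \<le> lam * (C * (1 / H ^ (2 * k))) * (v \<bullet> v)"
          if "v \<in> carrier_vec (card (J k))" for v
          using upB[OF that] up[OF scalar_prod_self_nonneg[of v], of k] by simp
        have "cond_number (B k) \<le> C * (1 / H ^ 2)"
        proof (cases "card (J k) = 0")
          case True
          then have "spectrum (B k) = {}" using B_sym_carrier(1)[OF k] spectrum_dim_0 by simp
          then have "cond_number (B k) = Max {} / Min {}"
            by (simp add: cond_number_def lambda_min_def lambda_max_def)
          also have "\<dots> \<le> C" using Cd2 C4(1) abs_ge_self[of "Max {} / Min {} :: real"] unfolding C_def by linarith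
          also have "\<dots> \<le> C * (1 / H\<^sup>2)" using mult_left_mono[OF H2, of C] C by simp
          finally show ?thesis .
        next
          case False
          \<comment> \<open>In the quotient the smallest eigenvalue cancels, and the powers of
            \<open>H\<close> differ by exactly two.\<close>
          have "cond_number (B k) \<le> (1 / (a k)\<^sup>2) / (1 / b\<^sup>2)"
            using False low upB b
            by (intro cond_number_le[OF B_sym_carrier[OF k]]) auto
          also have "\<dots> = Cd ^ 4 * (H ^ (2 * (k - 1)) / H ^ (2 * k))"
            unfolding a2 b2 using lam_pos assms H by (simp add: field_simps flip: power_add)
          also have "H ^ (2 * (k - 1)) / H ^ (2 * k) = 1 / H\<^sup>2"
          proof -
            have "2 * k = 2 * (k - 1) + 2" using k by simp
            then have "H ^ (2 * k) = H ^ (2 * (k - 1)) * H\<^sup>2" by (metis power_add)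
            then show ?thesis using H by simp
          qed
          also have "Cd ^ 4 * (1 / H\<^sup>2) \<le> C * (1 / H\<^sup>2)"
            using C4 H by (intro mult_right_mono) auto
          finally show ?thesis .
        qed
        with scaled_loewner_bounds[OF B_sym_carrier(1)[OF k] lam_pos] lowC upC show ?thesis by blast
      qed
      show ?case unfolding Let_def using partA condA partB by blast
    qed
  qed
qed

end
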